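(* Let $\pi$ be a semigroup, $\lambda\in K$, and let $(A,R)$ be a Rota-Baxter T-algebra of weight $\lambda$ indexed by $\pi$. (1) $(\{A_\varphi\}_{\varphi\in\pi},\{\prec_{p,q}\}_{p,q\in\pi},\{\succ_{p,q}\}_{p,q\in\pi},\{\bullet_{p,q}\}_{p,q\in\pi})$ is a tridendriform T-algebra, where for $a\in A_p$, $b\in A_q$, $p,q\in\pi$, $$a\prec_{p,q}b:=a\cdot_{p,q}R_q(b),\quad a\succ_{p,q}b:=R_p(a)\cdot_{p,q}b,\quad a\bullet_{p,q}b:=\lambda\,a\cdot_{p,q}b.$$ (2) $(\{A_\varphi\}_{\varphi\in\pi},\{\prec_{p,q}\}_{p,q\in\pi},\{\succ_{p,q}\}_{p,q\in\pi})$ is a dendriform T-algebra, where for $a\in A_p$, $b\in A_q$, $p,q\in\pi$, $$a\prec_{p,q}b:=a\cdot_{p,q}R_q(b)+\lambda\,a\cdot_{p,q}b,\quad a\succ_{p,q}b:=R_p(a)\cdot_{p,q}b.$$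
   Context: $K$ is a field; all vector spaces, tensor products and linear maps are over $K$. For a semigroup $\pi$, a T-algebra is a family of vector spaces $\{A_\varphi\}_{\varphi\in\pi}$ with linear maps $\mu_{p,q}:A_p\otimes A_q\to A_{pq}$ ($p,q\in\pi$), written $\mu_{p,q}(a\otimes b)=a\cdot_{p,q}b$, such that $(a\cdot_{p,q}b)\cdot_{pq,t}c=a\cdot_{p,qt}(b\cdot_{q,t}c)$ for all $p,q,t\in\pi$, $a\in A_p,b\in A_q,c\in A_t$. A Rota-Baxter T-algebra of weight $\lambda$, denoted $(A,R)$, is a T-algebra with linear maps $R=\{R_\varphi:A_\varphi\to A_\varphi\}_{\varphi\in\pi}$ such that $R_p(a)\cdot_{p,q}R_q(b)=R_{pq}\big(R_p(a)\cdot_{p,q}b+a\cdot_{p,q}R_q(b)+\lambda\, a\cdot_{p,q}b\big)$ for all $p,q\in\pi$, $a\in A_p$, $b\in A_q$. A dendriform T-algebra is a family of vector spaces $\{A_\varphi\}_{\varphi\in\pi}$ with bilinear operations (linear maps) $\prec_{p,q},\succ_{p,q}:A_p\otimes A_q\to A_{pq}$ such that for all $p,q,t\in\pi$, $a\in A_p,b\in A_q,c\in A_t$: $(a\prec_{p,q}b)\prec_{pq,t}c=a\prec_{p,qt}(b\prec_{q,t}c+b\succ_{q,t}c)$; $(a\succ_{p,q}b)\prec_{pq,t}c=a\succ_{p,qt}(b\prec_{q,t}c)$; $(a\prec_{p,q}b+a\succ_{p,q}b)\succ_{pq,t}c=a\succ_{p,qt}(b\succ_{q,t}c)$. A tridendriform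 T-algebra is a family of vector spaces $\{A_\varphi\}_{\varphi\in\pi}$ with bilinear operations $\prec_{p,q},\succ_{p,q},\bullet_{p,q}:A_p\otimes A_q\to A_{pq}$ such that for all $p,q,t\in\pi$, $a\in A_p,b\in A_q,c\in A_t$: $(a\prec_{p,q}b)\prec_{pq,t}c=a\prec_{p,qt}(b\prec_{q,t}c+b\succ_{q,t}c+b\bullet_{q,t}c)$; $(a\succ_{p,q}b)\prec_{pq,t}c=a\succ_{p,qt}(b\prec_{q,t}c)$; $(a\prec_{p,q}b+a\succ_{p,q}b+a\bullet_{p,q}b)\succ_{pq,t}c=a\succ_{p,qt}(b\succ_{q,t}c)$; $(a\succ_{p,q}b)\bullet_{pq,t}c=a\succ_{p,qt}(b\bullet_{q,t}c)$; $(a\prec_{p,q}b)\bullet_{pq,t}c=a\bullet_{p,qt}(b\succ_{q,t}c)$; $(a\bullet_{p,q}b)\prec_{pq,t}c=a\bullet_{p,qt}(b\prec_{q,t}c)$; $(a\bullet_{p,q}b)\bullet_{pq,t}c=a\bullet_{p,qt}(b\bullet_{q,t}c)$. *)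

theory Defs
  imports "Jordan_Normal_Form.Missing_VectorSpace"
begin

text \<open>
  Vector spaces over a field \<open>K\<close> are carrier-based (\<open>vectorspace\<close>), and a family of vector
  spaces indexed by a semigroup is a function \<open>A\<close> from a type of class \<open>semigroup_mult\<close> to
  module records: the spaces \<open>A p\<close> have independent carriers and operations, and only share the
  type that hosts their elements. An operation \<open>f p q\<close> on \<open>A p\<close> and \<open>A q\<close> is written
  prefix, with the indices first.
\<close>

text \<open>A linear map out of a tensor product \<open>U \<otimes> V\<close> is given as the corresponding bilinear map.\<close>

locale bilinear_map =
  U: vectorspace K U + V: vectorspace K V + W: vectorspace K W
  for K and U and V and W +
  fixes f
  assumes linear_right: "u \<in> carrier U \<Longrightarrow> linear_map K V W (f u)"
    and linear_left: "v \<in> carrier V \<Longrightarrow> linear_map K U W (\<lambda>u. f u v)"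

locale vectorspace_family =
  fixes K :: "('k, 'm) ring_scheme"
    and A :: "'p::semigroup_mult \<Rightarrow> ('k, 'v, 'n) module_scheme"
  assumes vectorspace: "vectorspace K (A p)"

locale T_algebra = vectorspace_family K A
  for K :: "('k, 'm) ring_scheme"
    and A :: "'p::semigroup_mult \<Rightarrow> ('k, 'v, 'n) module_scheme" +
  fixes mul :: "'p \<Rightarrow> 'p \<Rightarrow> 'v \<Rightarrow> 'v \<Rightarrow> 'v"
  assumes mul_bilinear: "bilinear_map K (A p) (A q) (A (p * q)) (mul p q)"
    and mul_assoc: "\<lbrakk>a \<in> carrier (A p); b \<in> carrier (A q); c \<in> carrier (A t)\<rbrakk> \<Longrightarrow>
      mul (p * q) t (mul p q a b) c = mul p (q * t) a (mul q t b c)"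

locale rota_baxter_T_algebra = T_algebra K A mul
  for K :: "('k, 'm) ring_scheme"
    and A :: "'p::semigroup_mult \<Rightarrow> ('k, 'v, 'n) module_scheme"
    and mul :: "'p \<Rightarrow> 'p \<Rightarrow> 'v \<Rightarrow> 'v \<Rightarrow> 'v" +
  fixes R :: "'p \<Rightarrow> 'v \<Rightarrow> 'v"
    and wt :: 'k
  assumes weight: "wt \<in> carrier K"
    and R_linear: "linear_map K (A p) (A p) (R p)"
    and rota_baxter: "\<lbrakk>a \<in> carrier (A p); b \<in> carrier (A q)\<rbrakk> \<Longrightarrow>
      mul p q (R p a) (R q b) =
      R (p * q) (mul p q (R p a) b \<oplus>\<^bsub>A (p * q)\<^esub> mul p q a (R q b)
                  \<oplus>\<^bsub>A (p * q)\<^esub> wt \<odot>\<^bsub>A (p * q)\<^esub> mul p q a b)"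

locale dendriform_T_algebra = vectorspace_family K A
  for K :: "('k, 'm) ring_scheme"
    and A :: "'p::semigroup_mult \<Rightarrow> ('k, 'v, 'n) module_scheme" +
  fixes prec succ :: "'p \<Rightarrow> 'p \<Rightarrow> 'v \<Rightarrow> 'v \<Rightarrow> 'v"
  assumes prec_bilinear: "bilinear_map K (A p) (A q) (A (p * q)) (prec p q)"
    and succ_bilinear: "bilinear_map K (A p) (A q) (A (p * q)) (succ p q)"
    and prec_prec: "\<lbrakk>a \<in> carrier (A p); b \<in> carrier (A q); c \<in> carrier (A t)\<rbrakk> \<Longrightarrow>
      prec (p * q) t (prec p q a b) c =
      prec p (q * t) a (prec q t b c \<oplus>\<^bsub>A (q * t)\<^esub> succ q t b c)"
    and succ_prec: "\<lbrakk>a \<in> carrier (A p); b \<in> carrier (A q); c \<in> carrier (A t)\<rbrakk> \<Longrightarrow>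
      prec (p * q) t (succ p q a b) c = succ p (q * t) a (prec q t b c)"
    and succ_succ: "\<lbrakk>a \<in> carrier (A p); b \<in> carrier (A q); c \<in> carrier (A t)\<rbrakk> \<Longrightarrow>
      succ (p * q) t (prec p q a b \<oplus>\<^bsub>A (p * q)\<^esub> succ p q a b) c =
      succ p (q * t) a (succ q t b c)"

locale tridendriform_T_algebra = vectorspace_family K A
  for K :: "('k, 'm) ring_scheme"
    and A :: "'p::semigroup_mult \<Rightarrow> ('k, 'v, 'n) module_scheme" +
  fixes prec succ bul :: "'p \<Rightarrow> 'p \<Rightarrow> 'v \<Rightarrow> 'v \<Rightarrow> 'v"
  assumes prec_bilinear: "bilinear_map K (A p) (A q) (A (p * q)) (prec p q)"
    and succ_bilinear: "bilinear_map K (A p) (A q) (A (p * q)) (succ p q)"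
    and bul_bilinear: "bilinear_map K (A p) (A q) (A (p * q)) (bul p q)"
    and prec_prec: "\<lbrakk>a \<in> carrier (A p); b \<in> carrier (A q); c \<in> carrier (A t)\<rbrakk> \<Longrightarrow>
      prec (p * q) t (prec p q a b) c =
      prec p (q * t) a
        (prec q t b c \<oplus>\<^bsub>A (q * t)\<^esub> succ q t b c \<oplus>\<^bsub>A (q * t)\<^esub> bul q t b c)"
    and succ_prec: "\<lbrakk>a \<in> carrier (A p); b \<in> carrier (A q); c \<in> carrier (A t)\<rbrakk> \<Longrightarrow>
      prec (p * q) t (succ p q a b) c = succ p (q * t) a (prec q t b c)"
    and succ_succ: "\<lbrakk>a \<in> carrier (A p); b \<in> carrier (A q); c \<in> carrier (A t)\<rbrakk> \<Longrightarrow>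
      succ (p * q) t
        (prec p q a b \<oplus>\<^bsub>A (p * q)\<^esub> succ p q a b \<oplus>\<^bsub>A (p * q)\<^esub> bul p q a b) c =
      succ p (q * t) a (succ q t b c)"
    and succ_bul: "\<lbrakk>a \<in> carrier (A p); b \<in> carrier (A q); c \<in> carrier (A t)\<rbrakk> \<Longrightarrow>
      bul (p * q) t (succ p q a b) c = succ p (q * t) a (bul q t b c)"
    and prec_bul: "\<lbrakk>a \<in> carrier (A p); b \<in> carrier (A q); c \<in> carrier (A t)\<rbrakk> \<Longrightarrow>
      bul (p * q) t (prec p q a b) c = bul p (q * t) a (succ q t b c)"
    and bul_prec: "\<lbrakk>a \<in> carrier (A p); b \<in> carrier (A q); c \<in> carrier (A t)\<rbrakk> \<Longrightarrow>
      prec (p * q) t (bul p q a b) c = bul p (q * t) a (prec q t b c)"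
    and bul_bul: "\<lbrakk>a \<in> carrier (A p); b \<in> carrier (A q); c \<in> carrier (A t)\<rbrakk> \<Longrightarrow>
      bul (p * q) t (bul p q a b) c = bul p (q * t) a (bul q t b c)"

end

theory Submission
  imports Defs
begin

text \<open>
  The tridendriform identities are associativity read off with \<open>R\<close> in the appropriate slots, the
  two containing a threefold sum being the Rota-Baxter identity under the product. Part (2) then
  holds for every tridendriform T-algebra: absorbing \<open>\<bullet>\<close> into \<open>\<prec>\<close> keeps the total
  product, and the first dendriform identity is the sum of the four tridendriform ones
  whose left-hand side involves \<open>\<prec>\<close> and \<open>\<bullet>\<close> only.
\<close>

text \<open>Unfolds the locale tower behind \<open>linear_map\<close> into its elementary equations,
  so that bilinearity can be proved and used by equational reasoning in each slot.\<close>

lemma linear_map_iff: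
  "linear_map K V W T \<longleftrightarrow> vectorspace K V \<and> vectorspace K W \<and>
     (\<forall>x\<in>carrier V. T x \<in> carrier W) \<and>
     (\<forall>x\<in>carrier V. \<forall>y\<in>carrier V. T (x \<oplus>\<^bsub>V\<^esub> y) = T x \<oplus>\<^bsub>W\<^esub> T y) \<and>
     (\<forall>r\<in>carrier K. \<forall>x\<in>carrier V. T (r \<odot>\<^bsub>V\<^esub> x) = r \<odot>\<^bsub>W\<^esub> T x)"
  by (auto simp: linear_map_def mod_hom_def mod_hom_axioms_def module_hom_def vectorspace_def)

context bilinear_map
begin

lemma closed: "\<lbrakk>u \<in> carrier U; v \<in> carrier V\<rbrakk> \<Longrightarrow> f u v \<in> carrier W"
  using linear_right by (auto simp: linear_map_iff)

lemma add_right: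
  "\<lbrakk>u \<in> carrier U; v \<in> carrier V; v' \<in> carrier V\<rbrakk> \<Longrightarrow>
     f u (v \<oplus>\<^bsub>V\<^esub> v') = f u v \<oplus>\<^bsub>W\<^esub> f u v'"
  using linear_right by (auto simp: linear_map_iff)

lemma add_left:
  "\<lbrakk>u \<in> carrier U; u' \<in> carrier U; v \<in> carrier V\<rbrakk> \<Longrightarrow>
     f (u \<oplus>\<^bsub>U\<^esub> u') v = f u v \<oplus>\<^bsub>W\<^esub> f u' v"
  using linear_left by (auto simp: linear_map_iff)

lemma smult_right:
  "\<lbrakk>r \<in> carrier K; u \<in> carrier U; v \<in> carrier V\<rbrakk> \<Longrightarrow> f u (r \<odot>\<^bsub>V\<^esub> v) = r \<odot>\<^bsub>W\<^esub> f u v"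
  using linear_right by (auto simp: linear_map_iff)

lemma smult_left:
  "\<lbrakk>r \<in> carrier K; u \<in> carrier U; v \<in> carrier V\<rbrakk> \<Longrightarrow> f (r \<odot>\<^bsub>U\<^esub> u) v = r \<odot>\<^bsub>W\<^esub> f u v"
  using linear_left by (auto simp: linear_map_iff)

end

lemma bilinear_mapI:
  assumes "vectorspace K U" "vectorspace K V" "vectorspace K W"
    and "\<And>u v. \<lbrakk>u \<in> carrier U; v \<in> carrier V\<rbrakk> \<Longrightarrow> f u v \<in> carrier W"
    and "\<And>u v v'. \<lbrakk>u \<in> carrier U; v \<in> carrier V; v' \<in> carrier V\<rbrakk> \<Longrightarrow>
      f u (v \<oplus>\<^bsub>V\<^esub> v') = f u v \<oplus>\<^bsub>W\<^esub> f u v'"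
    and "\<And>u u' v. \<lbrakk>u \<in> carrier U; u' \<in> carrier U; v \<in> carrier V\<rbrakk> \<Longrightarrow>
      f (u \<oplus>\<^bsub>U\<^esub> u') v = f u v \<oplus>\<^bsub>W\<^esub> f u' v"
    and "\<And>r u v. \<lbrakk>r \<in> carrier K; u \<in> carrier U; v \<in> carrier V\<rbrakk> \<Longrightarrow>
      f u (r \<odot>\<^bsub>V\<^esub> v) = r \<odot>\<^bsub>W\<^esub> f u v"
    and "\<And>r u v. \<lbrakk>r \<in> carrier K; u \<in> carrier U; v \<in> carrier V\<rbrakk> \<Longrightarrow>
      f (r \<odot>\<^bsub>U\<^esub> u) v = r \<odot>\<^bsub>W\<^esub> f u v"
  shows "bilinear_map K U V W f"
  using assms by (simp add: bilinear_map_def bilinear_map_axioms_def linear_map_iff)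

context bilinear_map
begin

text \<open>With \<open>g\<close> a component of \<open>R\<close>, this and the mirrored
  \<open>compose_left\<close> give bilinearity of the products that have \<open>R\<close> in one
  slot.\<close>

lemma compose_right:
  assumes "linear_map K V' V g"
  shows "bilinear_map K U V' W (\<lambda>u v. f u (g v))"
  using assms U.vectorspace_axioms W.vectorspace_axioms
  by (intro bilinear_mapI)
    (auto simp: linear_map_iff closed add_right add_left smult_right smult_left)

lemma compose_left:
  assumes "linear_map K U' U g"
  shows "bilinear_map K U' V W (\<lambda>u v. f (g u) v)"
  using assms V.vectorspace_axioms W.vectorspace_axioms
  by (intro bilinear_mapI)
    (auto simp: linear_map_iff closed add_right add_left smult_right smult_left)

lemma bilinear_smult:
  assumes "r \<in> carrier K"
  shows "bilinear_map K U V W (\<lambda>u v. r \<odot>\<^bsub>W\<^esub> f u v)"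
proof (rule bilinear_mapI)
  fix s u v
  assume "s \<in> carrier K" "u \<in> carrier U" "v \<in> carrier V"
  \<comment> \<open>The two scalars change places because \<open>K\<close> is commutative;
    homogeneity in either slot then follows from that of \<open>f\<close>.\<close>
  with assms have "r \<odot>\<^bsub>W\<^esub> (s \<odot>\<^bsub>W\<^esub> f u v) = s \<odot>\<^bsub>W\<^esub> (r \<odot>\<^bsub>W\<^esub> f u v)"
    by (metis W.smult_assoc1 U.R.m_comm closed)
  then show "r \<odot>\<^bsub>W\<^esub> f u (s \<odot>\<^bsub>V\<^esub> v) = s \<odot>\<^bsub>W\<^esub> (r \<odot>\<^bsub>W\<^esub> f u v)"
    and "r \<odot>\<^bsub>W\<^esub> f (s \<odot>\<^bsub>U\<^esub> u) v = s \<odot>\<^bsub>W\<^esub> (r \<odot>\<^bsub>W\<^esub> f u v)"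
    using \<open>s \<in> carrier K\<close> \<open>u \<in> carrier U\<close> \<open>v \<in> carrier V\<close>
    by (simp_all add: smult_right smult_left)
qed (use assms U.vectorspace_axioms V.vectorspace_axioms W.vectorspace_axioms in
    \<open>auto simp: closed add_right add_left W.smult_r_distr\<close>)

lemma bilinear_add:
  assumes "bilinear_map K U V W g"
  shows "bilinear_map K U V W (\<lambda>u v. f u v \<oplus>\<^bsub>W\<^esub> g u v)"
proof -
  interpret g: bilinear_map K U V W g by fact
  show ?thesis
    using U.vectorspace_axioms V.vectorspace_axioms W.vectorspace_axioms
    by (intro bilinear_mapI)
      (auto simp: closed add_right add_left smult_right smult_left g.closed g.add_right g.add_left
        g.smult_right g.smult_left W.smult_r_distr W.a_ac)
qed

end

lemma (in tridendriform_T_algebra) dendriform: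
  "dendriform_T_algebra K A (\<lambda>p q a b. prec p q a b \<oplus>\<^bsub>A (p * q)\<^esub> bul p q a b) succ"
proof (intro dendriform_T_algebra.intro dendriform_T_algebra_axioms.intro)
  show "vectorspace_family K A" ..
next
  fix p q
  show "bilinear_map K (A p) (A q) (A (p * q))
      (\<lambda>a b. prec p q a b \<oplus>\<^bsub>A (p * q)\<^esub> bul p q a b)"
    using prec_bilinear bul_bilinear by (rule bilinear_map.bilinear_add)
  show "bilinear_map K (A p) (A q) (A (p * q)) (succ p q)"
    by (rule succ_bilinear)
next
  fix a b c p q t
  assume a: "a \<in> carrier (A p)" and b: "b \<in> carrier (A q)" and c: "c \<in> carrier (A t)"
  interpret pq: vectorspace K "A (p * q)" by (rule vectorspace)
  interpret qt: vectorspace K "A (q * t)" by (rule vectorspace)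
  interpret pqt: vectorspace K "A (p * (q * t))" by (rule vectorspace)
  note prec = bilinear_map.closed[OF prec_bilinear]
    bilinear_map.add_right[OF prec_bilinear] bilinear_map.add_left[OF prec_bilinear]
  note succ = bilinear_map.closed[OF succ_bilinear]
    bilinear_map.add_right[OF succ_bilinear] bilinear_map.add_left[OF succ_bilinear]
  note bul = bilinear_map.closed[OF bul_bilinear]
    bilinear_map.add_right[OF bul_bilinear] bilinear_map.add_left[OF bul_bilinear]
  \<comment> \<open>The two sides of each identity live over differently bracketed indices.
    Associativity of the semigroup makes these the same module, hence with the same
    addition.\<close>
  have ass: "A (p * q * t) = A (p * (q * t))"
    by (simp add: mult.assoc)
  note closed = prec(1)[OF a b] succ(1)[OF a b] bul(1)[OF a b]
    prec(1)[OF b c] succ(1)[OF b c] bul(1)[OF b c]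
  \<comment> \<open>The new operations sum to the total product in the order \<open>prec\<close>,
    \<open>bul\<close>, \<open>succ\<close>, while the tridendriform axioms list \<open>bul\<close>
    last.\<close>
  have total: "(prec q t b c \<oplus>\<^bsub>A (q * t)\<^esub> bul q t b c) \<oplus>\<^bsub>A (q * t)\<^esub> succ q t b c
      = prec q t b c \<oplus>\<^bsub>A (q * t)\<^esub> succ q t b c \<oplus>\<^bsub>A (q * t)\<^esub> bul q t b c"
    and total': "(prec p q a b \<oplus>\<^bsub>A (p * q)\<^esub> bul p q a b) \<oplus>\<^bsub>A (p * q)\<^esub> succ p q a b
      = prec p q a b \<oplus>\<^bsub>A (p * q)\<^esub> succ p q a b \<oplus>\<^bsub>A (p * q)\<^esub> bul p q a b"
    using closed by (simp_all add: qt.a_ac pq.a_ac)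
  \<comment> \<open>Additivity splits the left side into four terms. \<open>prec_prec\<close> turns
    one into \<open>prec\<close> of \<open>a\<close> with the total product of \<open>b\<close> and
    \<open>c\<close>; \<open>bul_prec\<close>, \<open>prec_bul\<close> and \<open>bul_bul\<close>
    turn the others into \<open>bul\<close> of \<open>a\<close> with its three summands, which
    recombine.\<close>
  show "prec (p * q) t (prec p q a b \<oplus>\<^bsub>A (p * q)\<^esub> bul p q a b) c \<oplus>\<^bsub>A (p * q * t)\<^esub>
      bul (p * q) t (prec p q a b \<oplus>\<^bsub>A (p * q)\<^esub> bul p q a b) c =
    prec p (q * t) a
      (prec q t b c \<oplus>\<^bsub>A (q * t)\<^esub> bul q t b c \<oplus>\<^bsub>A (q * t)\<^esub> succ q t b c) \<oplus>\<^bsub>A (p * (q * t))\<^esub>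
    bul p (q * t) a
      (prec q t b c \<oplus>\<^bsub>A (q * t)\<^esub> bul q t b c \<oplus>\<^bsub>A (q * t)\<^esub> succ q t b c)"
    using a b c closed
    by (simp add: total prec(2-) bul(2-) prec_prec prec_bul bul_prec bul_bul ass
        prec(1) bul(1) pqt.a_ac)
  \<comment> \<open>The sum of \<open>succ_prec\<close> and \<open>succ_bul\<close>, collected by
    additivity of \<open>succ\<close> on the right.\<close>
  show "prec (p * q) t (succ p q a b) c \<oplus>\<^bsub>A (p * q * t)\<^esub> bul (p * q) t (succ p q a b) c =
    succ p (q * t) a (prec q t b c \<oplus>\<^bsub>A (q * t)\<^esub> bul q t b c)"
    using a b c closed by (simp add: succ(2) succ_prec succ_bul ass)
  show "succ (p * q) t
      (prec p q a b \<oplus>\<^bsub>A (p * q)\<^esub> bul p q a b \<oplus>\<^bsub>A (p * q)\<^esub> succ p q a b) c =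
    succ p (q * t) a (succ q t b c)"
    using succ_succ[OF a b c] by (simp only: total')
qed

lemma (in rota_baxter_T_algebra) tridendriform:
  "tridendriform_T_algebra K A
     (\<lambda>p q a b. mul p q a (R q b))
     (\<lambda>p q a b. mul p q (R p a) b)
     (\<lambda>p q a b. wt \<odot>\<^bsub>A (p * q)\<^esub> mul p q a b)"
proof (intro tridendriform_T_algebra.intro tridendriform_T_algebra_axioms.intro)
  show "vectorspace_family K A" ..
next
  fix p q
  show "bilinear_map K (A p) (A q) (A (p * q)) (\<lambda>a b. mul p q a (R q b))"
    using mul_bilinear R_linear by (rule bilinear_map.compose_right)
  show "bilinear_map K (A p) (A q) (A (p * q)) (\<lambda>a b. mul p q (R p a) b)"
    using mul_bilinear R_linear by (rule bilinear_map.compose_left)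
  show "bilinear_map K (A p) (A q) (A (p * q)) (\<lambda>a b. wt \<odot>\<^bsub>A (p * q)\<^esub> mul p q a b)"
    using mul_bilinear weight by (rule bilinear_map.bilinear_smult)
next
  fix a b c p q t
  assume a: "a \<in> carrier (A p)" and b: "b \<in> carrier (A q)" and c: "c \<in> carrier (A t)"
  interpret pq: vectorspace K "A (p * q)" by (rule vectorspace)
  interpret qt: vectorspace K "A (q * t)" by (rule vectorspace)
  have R: "R r x \<in> carrier (A r)" if "x \<in> carrier (A r)" for r x
    using R_linear[of r] that by (auto simp: linear_map_iff)
  note closed = bilinear_map.closed[OF mul_bilinear]
  note smult = bilinear_map.smult_right[OF mul_bilinear weight]
    bilinear_map.smult_left[OF mul_bilinear weight]
  have ass: "A (p * q * t) = A (p * (q * t))"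
    by (simp add: mult.assoc)
  \<comment> \<open>\<open>rota_baxter\<close> puts the term with \<open>R\<close> on the left
    factor first, whereas the tridendriform sums begin with \<open>prec\<close>, whose
    \<open>R\<close> is on the right. Generic indices cover both (p,q) and (q,t).\<close>
  have comm: "mul r s (R r x) y \<oplus>\<^bsub>A (r * s)\<^esub> mul r s x (R s y)
      = mul r s x (R s y) \<oplus>\<^bsub>A (r * s)\<^esub> mul r s (R r x) y"
    if "x \<in> carrier (A r)" "y \<in> carrier (A s)" for r s x y
  proof -
    interpret rs: vectorspace K "A (r * s)" by (rule vectorspace)
    show ?thesis using that by (intro rs.a_comm closed R)
  qed
  \<comment> \<open>Bracketing to the right brings \<open>R q b\<close> and \<open>R t c\<close>
    together, and the Rota-Baxter identity rewrites their product.\<close>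
  show "mul (p * q) t (mul p q a (R q b)) (R t c) =
      mul p (q * t) a (R (q * t)
        (mul q t b (R t c) \<oplus>\<^bsub>A (q * t)\<^esub> mul q t (R q b) c \<oplus>\<^bsub>A (q * t)\<^esub>
         wt \<odot>\<^bsub>A (q * t)\<^esub> mul q t b c))"
    using a b c by (simp add: mul_assoc R rota_baxter comm)
  \<comment> \<open>The mirror case: associativity is used backwards, so that \<open>R p a\<close>
    and \<open>R q b\<close> meet.\<close>
  show "mul (p * q) t (R (p * q)
        (mul p q a (R q b) \<oplus>\<^bsub>A (p * q)\<^esub> mul p q (R p a) b \<oplus>\<^bsub>A (p * q)\<^esub>
         wt \<odot>\<^bsub>A (p * q)\<^esub> mul p q a b)) c =
      mul p (q * t) (R p a) (mul q t (R q b) c)"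
    using a b c by (simp add: mul_assoc[symmetric] R rota_baxter comm)
  show "mul (p * q) t (mul p q (R p a) b) (R t c) = mul p (q * t) (R p a) (mul q t b (R t c))"
    using a b c by (simp add: mul_assoc R)
  \<comment> \<open>Once \<open>wt\<close> is pulled out of every slot, both sides carry the same
    power of it, and what remains is associativity.\<close>
  show "wt \<odot>\<^bsub>A (p * q * t)\<^esub> mul (p * q) t (mul p q (R p a) b) c =
      mul p (q * t) (R p a) (wt \<odot>\<^bsub>A (q * t)\<^esub> mul q t b c)"
    and "wt \<odot>\<^bsub>A (p * q * t)\<^esub> mul (p * q) t (mul p q a (R q b)) c =
      wt \<odot>\<^bsub>A (p * (q * t))\<^esub> mul p (q * t) a (mul q t (R q b) c)"
    and "mul (p * q) t (wt \<odot>\<^bsub>A (p * q)\<^esub> mul p q a b) (R t c) =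
      wt \<odot>\<^bsub>A (p * (q * t))\<^esub> mul p (q * t) a (mul q t b (R t c))"
    and "wt \<odot>\<^bsub>A (p * q * t)\<^esub> mul (p * q) t (wt \<odot>\<^bsub>A (p * q)\<^esub> mul p q a b) c =
      wt \<odot>\<^bsub>A (p * (q * t))\<^esub> mul p (q * t) a (wt \<odot>\<^bsub>A (q * t)\<^esub> mul q t b c)"
    using a b c by (simp_all add: mul_assoc R smult closed ass)
qed

theorem proposition2p25:
  fixes K :: "('k, 'm) ring_scheme"
    and A :: "'p::semigroup_mult \<Rightarrow> ('k, 'v, 'n) module_scheme"
    and mul :: "'p \<Rightarrow> 'p \<Rightarrow> 'v \<Rightarrow> 'v \<Rightarrow> 'v"
    and R :: "'p \<Rightarrow> 'v \<Rightarrow> 'v"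
    and wt :: 'k
  assumes "field K"
    and "wt \<in> carrier K"
    and "rota_baxter_T_algebra K A mul R wt"
  shows "tridendriform_T_algebra K A
           (\<lambda>p q a b. mul p q a (R q b))
           (\<lambda>p q a b. mul p q (R p a) b)
           (\<lambda>p q a b. wt \<odot>\<^bsub>A (p * q)\<^esub> mul p q a b)
       \<and> dendriform_T_algebra K A
           (\<lambda>p q a b. mul p q a (R q b) \<oplus>\<^bsub>A (p * q)\<^esub> wt \<odot>\<^bsub>A (p * q)\<^esub> mul p q a b)
           (\<lambda>p q a b. mul p q (R p a) b)"
proof -
  interpret rota_baxter_T_algebra K A mul R wt by fact
  show ?thesis
    \<comment> \<open>For the operations of part (1), \<open>prec\<close> plus \<open>bul\<close> is
      exactly the left operation of part (2), and \<open>succ\<close> is unchanged.\<close>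
    using tridendriform tridendriform_T_algebra.dendriform[OF tridendriform] by blast
qed

end
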